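(* Let $p_j\to\infty$ with $p_j\in(1,\infty)$, and for each $j$ let $(f_{p_j},\lambda_{p_j})$ be a $p_j$-Laplacian eigenpair on $G$ (with homogeneous Dirichlet conditions on $B$). Assume that $\lim_{j\to\infty}\big(f_{p_j},\lambda_{p_j}^{1/p_j}\big)=(f,\Lambda)$. Then $(f,\Lambda)$ satisfies, for all $u\in V_I$, $$0=\begin{cases}\min\{\|\{\nabla f\}(u)\|_\infty-\Lambda f(u),\ \Delta_\infty f(u)\} & \text{if } f(u)>0,\\ \Delta_\infty f(u) & \text{if } f(u)=0,\\ \max\{-\|\{\nabla f\}(u)\|_\infty-\Lambda f(u),\ \Delta_\infty f(u)\} & \text{if } f(u)<0.\end{cases}$$
   Context: $G=(V,E,\omega)$ is a finite undirected weighted graph: $E\subset V\times V$ is symmetric and $\omega_{uv}=\omega_{vu}>0$ for $(u,v)\in E$; $u\sim v$ means $(u,v)\in E$. $B\subset V$ (possibly empty) is the boundary and $V_I=V\setminus B\neq\emptyset$ the set of internal nodes. $G$ is connected: if $B=\emptyset$ any two nodes are joined by a path; if $B\ne\emptyset$ the subgraph induced by $V_I$ is connected and at least one internal node is adjacent to $B$. $\mathcal H_0(V)=\{f:V\to\mathbb R:\ f=0 \text{ on } B\}$. For $f\in\mathcal H_0(V)$: $\nabla f(u,v)=\omega_{uv}(f(v)-f(u))$ for $(u,v)\in E$. With $x^+=\max\{x,0\}$ and $x^-=\max\{-x,0\}$, set $\|\{\nabla f\}(u)\|_\infty=\max_{v\sim u}|\nabla f(u,v)|$, $\|\{\nabla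 f\}^{\pm}(u)\|_\infty=\max_{v\sim u}(\nabla f(u,v))^{\pm}$ (a maximum over the empty set is $0$), and $\Delta_\infty f(u)=\|\{\nabla f\}^-(u)\|_\infty-\|\{\nabla f\}^+(u)\|_\infty$. For $p\in(1,\infty)$, $\Delta_pf(u)=\sum_{v\sim u}\omega_{uv}^p|f(u)-f(v)|^{p-2}(f(u)-f(v))$. A $p$-Laplacian eigenpair is a pair $(f,\lambda)$ with $0\ne f\in\mathcal H_0(V)$, $\lambda\in\mathbb R$, and $\Delta_pf(u)=\lambda|f(u)|^{p-2}f(u)$ for all $u\in V_I$. (All such $\lambda$ are nonnegative.) *)

theory Defs
  imports Complex_Main
begin

text \<open>
  The node set is a carrier set \<open>V\<close> of an arbitrary type. A function \<open>V \<rightarrow> \<real>\<close> is represented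
  by a HOL function of which only the values on \<open>V\<close> matter.
\<close>

definition connected_on :: "('a \<times> 'a) set \<Rightarrow> 'a set \<Rightarrow> bool" where
  "connected_on E A \<longleftrightarrow> (\<forall>u\<in>A. \<forall>v\<in>A. (u, v) \<in> (E \<inter> A \<times> A)\<^sup>*)"

text \<open>Loops are not excluded.\<close>

locale weighted_graph_with_boundary =
  fixes V :: "'a set" and E :: "('a \<times> 'a) set" and \<omega> :: "'a \<Rightarrow> 'a \<Rightarrow> real" and B :: "'a set"
  assumes finite_nodes: "finite V"
    and edges_subset: "E \<subseteq> V \<times> V"
    and edges_sym: "sym E"
    and weight_sym: "(u, v) \<in> E \<Longrightarrow> \<omega> u v = \<omega> v u"
    and weight_pos: "(u, v) \<in> E \<Longrightarrow> 0 < \<omega> u v"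
    and boundary_subset: "B \<subseteq> V"
    and internal_nonempty: "V - B \<noteq> {}"
    and connected_no_boundary: "B = {} \<Longrightarrow> connected_on E V"
    and connected_internal: "B \<noteq> {} \<Longrightarrow> connected_on E (V - B)"
    and boundary_adjacent: "B \<noteq> {} \<Longrightarrow> \<exists>u\<in>V - B. \<exists>v\<in>B. (u, v) \<in> E"

definition H0 :: "'a set \<Rightarrow> ('a \<Rightarrow> real) set" where
  "H0 B = {f. \<forall>v\<in>B. f v = 0}"

definition neighbours :: "('a \<times> 'a) set \<Rightarrow> 'a \<Rightarrow> 'a set" where
  "neighbours E u = {v. (u, v) \<in> E}"

definition grad :: "('a \<Rightarrow> 'a \<Rightarrow> real) \<Rightarrow> ('a \<Rightarrow> real) \<Rightarrow> 'a \<Rightarrow> 'a \<Rightarrow> real" where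
  "grad \<omega> f u v = \<omega> u v * (f v - f u)"

definition pos_part :: "real \<Rightarrow> real" where
  "pos_part x = max x 0"

definition neg_part :: "real \<Rightarrow> real" where
  "neg_part x = max (- x) 0"

definition max_or_zero :: "real set \<Rightarrow> real" where
  "max_or_zero S = (if S = {} then 0 else Max S)"

definition grad_norm ::
  "('a \<times> 'a) set \<Rightarrow> ('a \<Rightarrow> 'a \<Rightarrow> real) \<Rightarrow> ('a \<Rightarrow> real) \<Rightarrow> 'a \<Rightarrow> real" where
  "grad_norm E \<omega> f u = max_or_zero ((\<lambda>v. \<bar>grad \<omega> f u v\<bar>) ` neighbours E u)"

definition grad_pos_norm ::
  "('a \<times> 'a) set \<Rightarrow> ('a \<Rightarrow> 'a \<Rightarrow> real) \<Rightarrow> ('a \<Rightarrow> real) \<Rightarrow> 'a \<Rightarrow> real" where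
  "grad_pos_norm E \<omega> f u = max_or_zero ((\<lambda>v. pos_part (grad \<omega> f u v)) ` neighbours E u)"

definition grad_neg_norm ::
  "('a \<times> 'a) set \<Rightarrow> ('a \<Rightarrow> 'a \<Rightarrow> real) \<Rightarrow> ('a \<Rightarrow> real) \<Rightarrow> 'a \<Rightarrow> real" where
  "grad_neg_norm E \<omega> f u = max_or_zero ((\<lambda>v. neg_part (grad \<omega> f u v)) ` neighbours E u)"

definition inf_laplacian ::
  "('a \<times> 'a) set \<Rightarrow> ('a \<Rightarrow> 'a \<Rightarrow> real) \<Rightarrow> ('a \<Rightarrow> real) \<Rightarrow> 'a \<Rightarrow> real" where
  "inf_laplacian E \<omega> f u = grad_neg_norm E \<omega> f u - grad_pos_norm E \<omega> f u"

text \<open>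
  For \<open>1 < p < 2\<close> the expression \<open>\<bar>x\<bar> powr (p - 2) * x\<close> has the value \<open>0\<close> at \<open>x = 0\<close>, which is
  its continuous extension and the usual convention.
\<close>

definition p_laplacian ::
  "('a \<times> 'a) set \<Rightarrow> ('a \<Rightarrow> 'a \<Rightarrow> real) \<Rightarrow> real \<Rightarrow> ('a \<Rightarrow> real) \<Rightarrow> 'a \<Rightarrow> real" where
  "p_laplacian E \<omega> p f u =
     (\<Sum>v\<in>neighbours E u. \<omega> u v powr p * \<bar>f u - f v\<bar> powr (p - 2) * (f u - f v))"

definition p_eigenpair ::
  "'a set \<Rightarrow> ('a \<times> 'a) set \<Rightarrow> ('a \<Rightarrow> 'a \<Rightarrow> real) \<Rightarrow> 'a set \<Rightarrow> real \<Rightarrow> ('a \<Rightarrow> real) \<Rightarrow> real \<Rightarrow> bool"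
where
  "p_eigenpair V E \<omega> B p f l \<longleftrightarrow>
     f \<in> H0 B \<and> (\<exists>v\<in>V. f v \<noteq> 0) \<and>
     (\<forall>u\<in>V - B. p_laplacian E \<omega> p f u = l * \<bar>f u\<bar> powr (p - 2) * f u)"

end

theory Submission
  imports Defs
begin

text \<open>
  The idea is to separate signs and to take a root. Fix an internal node \<open>u\<close> and an eigenpair
  \<open>(g, l)\<close> of order \<open>p\<close>, and write \<open>q = p - 1\<close> and \<open>l' = l powr (1 / q)\<close>. Every summand of the
  \<open>p\<close>-Laplacian is, up to the factor \<open>\<omega> u v\<close>, a signed \<open>q\<close>-th power of the gradient, and the
  right-hand side of the eigenvalue equation is a signed \<open>q\<close>-th power of \<open>l' * g u\<close>. Moving all
  negative contributions to the other side equates two sums of \<open>q\<close>-th powers of nonnegative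
  quantities (\<open>p_eigen_equation_split\<close>): the sum over \<open>v\<close> of
  \<open>\<omega> u v * neg_part (grad \<omega> g u v) powr q\<close> plus \<open>(l' * neg_part (g u)) powr q\<close>, and the same
  expression with positive parts.

  As \<open>p\<close> grows, the \<open>q\<close>-th root of such a sum tends to the maximum of the limits of its entries
  (\<open>tendsto_weighted_power_mean\<close>). In the limit the identity therefore becomes
  (\<open>limit_eigen_equation\<close>)

  \<open>max (grad_neg_norm E \<omega> f u) (\<Lambda> * neg_part (f u)) = max (grad_pos_norm E \<omega> f u) (\<Lambda> * pos_part (f u))\<close>,

  whatever the signs of the approximating values at \<open>u\<close>. The three cases of the theorem are this one
  equation, read for \<open>f u > 0\<close>, \<open>f u = 0\<close> and \<open>f u < 0\<close>, because \<open>grad_norm\<close> is the maximum of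
  \<open>grad_neg_norm\<close> and \<open>grad_pos_norm\<close>.

  Taking roots of \<open>l\<close> is legitimate because eigenvalues are nonnegative, which follows from looking
  at a node where \<open>\<bar>g\<bar>\<close> is maximal (\<open>p_eigenvalue_nonneg\<close>).
\<close>

section \<open>Maxima of nonnegative families\<close>

lemma max_or_zero_insert:
  assumes "finite S" "0 \<le> x"
  shows "max_or_zero (insert x S) = max x (max_or_zero S)"
  using assms by (simp add: max_or_zero_def)

lemma max_or_zero_nonneg:
  assumes "finite S" "\<And>x. x \<in> S \<Longrightarrow> 0 \<le> x"
  shows "0 \<le> max_or_zero S"
  using assms by (auto simp: max_or_zero_def intro: order.trans[OF _ Max_ge])

lemma max_or_zero_abs:
  assumes "finite A"
  shows "max_or_zero ((\<lambda>v. \<bar>g v\<bar>) ` A) =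
    max (max_or_zero ((\<lambda>v. neg_part (g v)) ` A)) (max_or_zero ((\<lambda>v. pos_part (g v)) ` A))"
  using assms
proof (induction A)
  case empty
  then show ?case by (simp add: max_or_zero_def)
next
  case (insert a A)
  have "\<bar>g a\<bar> = max (neg_part (g a)) (pos_part (g a))"
    by (simp add: neg_part_def pos_part_def)
  moreover have "0 \<le> neg_part (g a)" "0 \<le> pos_part (g a)"
    by (simp_all add: neg_part_def pos_part_def)
  ultimately show ?case
    using insert by (simp add: max_or_zero_insert max.assoc max.left_commute)
qed

section \<open>Power means of order tending to infinity\<close>

text \<open>
  The root lies between \<open>max r s\<close> and \<open>2 powr (1 / q) * max r s\<close>, and \<open>2 powr (1 / q)\<close> tends to 1.
\<close>

lemma tendsto_power_mean_pair:
  fixes r s q :: "nat \<Rightarrow> real"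
  assumes q: "filterlim q at_top sequentially" "\<And>j. 0 < q j"
    and r: "r \<longlonglongrightarrow> a" "\<And>j. 0 \<le> r j" and s: "s \<longlonglongrightarrow> b" "\<And>j. 0 \<le> s j"
  shows "(\<lambda>j. (r j powr q j + s j powr q j) powr (1 / q j)) \<longlonglongrightarrow> max a b"
proof (rule tendsto_sandwich)
  have m: "(\<lambda>j. max (r j) (s j)) \<longlonglongrightarrow> max a b"
    using r s by (intro tendsto_max)
  show "(\<lambda>j. max (r j) (s j)) \<longlonglongrightarrow> max a b" by (fact m)
  have "(\<lambda>j. 1 / q j) \<longlonglongrightarrow> 0"
    using q(1) by (intro real_tendsto_divide_at_top[OF tendsto_const])
  then have "(\<lambda>j. 2 powr (1 / q j)) \<longlonglongrightarrow> 2 powr (0::real)"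
    by (intro tendsto_powr tendsto_const) auto
  from tendsto_mult[OF this m]
  show "(\<lambda>j. 2 powr (1 / q j) * max (r j) (s j)) \<longlonglongrightarrow> max a b" by simp
  have low: "max (r j) (s j) \<le> (r j powr q j + s j powr q j) powr (1 / q j)" for j
  proof -
    have "max (r j) (s j) powr q j \<le> r j powr q j + s j powr q j"
      by (auto simp: max_def)
    then have "(max (r j) (s j) powr q j) powr (1 / q j)
        \<le> (r j powr q j + s j powr q j) powr (1 / q j)"
      using q(2)[of j] by (intro powr_mono2) auto
    then show ?thesis
      using q(2)[of j] r(2)[of j] by (simp add: powr_powr powr_one' max_def split: if_splits)
  qed
  then show "\<forall>\<^sub>F j in sequentially.
      max (r j) (s j) \<le> (r j powr q j + s j powr q j) powr (1 / q j)" by simp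
  have up: "(r j powr q j + s j powr q j) powr (1 / q j) \<le> 2 powr (1 / q j) * max (r j) (s j)" for j
  proof -
    have "r j powr q j \<le> max (r j) (s j) powr q j" "s j powr q j \<le> max (r j) (s j) powr q j"
      using q(2)[of j] r(2)[of j] s(2)[of j] by (auto intro!: powr_mono2)
    then have "(r j powr q j + s j powr q j) powr (1 / q j)
        \<le> (2 * max (r j) (s j) powr q j) powr (1 / q j)"
      using q(2)[of j] by (intro powr_mono2) auto
    also have "\<dots> = 2 powr (1 / q j) * max (r j) (s j)"
      using q(2)[of j] r(2)[of j]
      by (simp add: powr_mult powr_powr powr_one' max_def split: if_splits)
    finally show ?thesis .
  qed
  then show "\<forall>\<^sub>F j in sequentially.
      (r j powr q j + s j powr q j) powr (1 / q j) \<le> 2 powr (1 / q j) * max (r j) (s j)" by simp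
qed

text \<open>
  Fixed positive weights disappear in the limit, since \<open>c powr (1 / q)\<close> tends to 1; they can be
  absorbed into the entries, so that the sum can be built up one entry at a time.
\<close>

lemma tendsto_weighted_power_mean:
  fixes x :: "nat \<Rightarrow> 'b \<Rightarrow> real" and q :: "nat \<Rightarrow> real"
  assumes q: "filterlim q at_top sequentially" "\<And>j. 0 < q j" and "finite A"
    and c: "\<And>v. v \<in> A \<Longrightarrow> 0 < c v"
    and x: "\<And>v. v \<in> A \<Longrightarrow> (\<lambda>j. x j v) \<longlonglongrightarrow> y v" "\<And>j v. v \<in> A \<Longrightarrow> 0 \<le> x j v"
  shows "(\<lambda>j. (\<Sum>v\<in>A. c v * x j v powr q j) powr (1 / q j)) \<longlonglongrightarrow> max_or_zero (y ` A)"
  using \<open>finite A\<close> c x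
proof (induction A)
  case empty
  then show ?case by (simp add: max_or_zero_def)
next
  case (insert a A)
  define S where "S j = (\<Sum>v\<in>A. c v * x j v powr q j)" for j
  have S_nonneg: "0 \<le> S j" for j
    unfolding S_def using insert.prems by (intro sum_nonneg mult_nonneg_nonneg) (auto intro: less_imp_le)
  have S_lim: "(\<lambda>j. S j powr (1 / q j)) \<longlonglongrightarrow> max_or_zero (y ` A)"
    unfolding S_def using insert by auto
  have "(\<lambda>j. 1 / q j) \<longlonglongrightarrow> 0"
    using q(1) by (intro real_tendsto_divide_at_top[OF tendsto_const])
  then have "(\<lambda>j. c a powr (1 / q j)) \<longlonglongrightarrow> c a powr 0"
    using insert.prems(1)[of a] by (intro tendsto_powr tendsto_const) auto
  from tendsto_mult[OF this insert.prems(2)[of a]]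
  have "(\<lambda>j. c a powr (1 / q j) * x j a) \<longlonglongrightarrow> y a"
    using insert.prems(1)[of a] by simp
  then have lim: "(\<lambda>j. ((c a powr (1 / q j) * x j a) powr q j + (S j powr (1 / q j)) powr q j)
      powr (1 / q j)) \<longlonglongrightarrow> max (y a) (max_or_zero (y ` A))"
    using S_lim insert.prems by (intro tendsto_power_mean_pair q) auto
  have eq: "(c a powr (1 / q j) * x j a) powr q j + (S j powr (1 / q j)) powr q j
      = (\<Sum>v\<in>insert a A. c v * x j v powr q j)" for j
    using insert.hyps insert.prems(1)[of a] insert.prems(3)[of a j] q(2)[of j] S_nonneg[of j]
    by (simp add: powr_mult powr_powr powr_one' S_def[symmetric])
  have "0 \<le> y a"
    using insert.prems by (intro LIMSEQ_le_const[of "\<lambda>j. x j a"]) auto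
  then show ?case
    using lim insert.hyps by (simp only: eq image_insert) (simp add: max_or_zero_insert)
qed

section \<open>The eigenvalue equation at one node\<close>

text \<open>
  At a node \<open>u\<close> maximising \<open>\<bar>f\<bar>\<close> no difference \<open>f u - f v\<close> has the sign opposite to \<open>f u\<close>, hence nor does
  the \<open>p\<close>-Laplacian. Such a node is internal because \<open>f\<close> vanishes on the boundary.
\<close>

lemma (in weighted_graph_with_boundary) p_eigenvalue_nonneg:
  assumes "p_eigenpair V E \<omega> B p f l"
  shows "0 \<le> l"
proof -
  obtain w where w: "w \<in> V" "f w \<noteq> 0" using assms by (auto simp: p_eigenpair_def)
  have "Max ((\<lambda>v. \<bar>f v\<bar>) ` V) \<in> (\<lambda>v. \<bar>f v\<bar>) ` V"
    using finite_nodes w by (intro Max_in) auto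
  then obtain u where u: "u \<in> V" "Max ((\<lambda>v. \<bar>f v\<bar>) ` V) = \<bar>f u\<bar>" by auto
  have max: "\<bar>f v\<bar> \<le> \<bar>f u\<bar>" if "v \<in> V" for v
    using that finite_nodes u(2)[symmetric] by simp
  have fu: "f u \<noteq> 0" using max[OF w(1)] w(2) by auto
  then have "u \<notin> B" using assms by (auto simp: p_eigenpair_def H0_def)
  then have eq: "p_laplacian E \<omega> p f u = l * \<bar>f u\<bar> powr (p - 2) * f u"
    using assms u(1) by (auto simp: p_eigenpair_def)
  have "0 \<le> (\<Sum>v\<in>neighbours E u. \<omega> u v powr p * \<bar>f u - f v\<bar> powr (p - 2) * ((f u - f v) * f u))"
  proof (rule sum_nonneg)
    fix v assume "v \<in> neighbours E u"
    then have "v \<in> V" using edges_subset by (auto simp: neighbours_def)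
    from max[OF this] have "0 \<le> (f u - f v) * f u"
      by (auto simp: zero_le_mult_iff abs_if split: if_splits)
    then show "0 \<le> \<omega> u v powr p * \<bar>f u - f v\<bar> powr (p - 2) * ((f u - f v) * f u)"
      by (rule mult_nonneg_nonneg[rotated]) simp
  qed
  also have "\<dots> = p_laplacian E \<omega> p f u * f u"
    by (simp add: p_laplacian_def sum_distrib_right mult.assoc)
  also have "\<dots> = l * (\<bar>f u\<bar> powr (p - 2) * (f u)\<^sup>2)"
    by (simp add: eq power2_eq_square mult_ac)
  finally have "0 \<le> l * (\<bar>f u\<bar> powr (p - 2) * (f u)\<^sup>2)" .
  moreover have "0 < \<bar>f u\<bar> powr (p - 2) * (f u)\<^sup>2" using fu by simp
  ultimately show ?thesis by (simp only: zero_le_mult_iff) linarith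
qed

text \<open>
  For \<open>w = \<omega> u v\<close> and \<open>d = f u - f v\<close> the left-hand side is a summand of the \<open>p\<close>-Laplacian; for
  \<open>w = 1\<close> and \<open>d = f u\<close> it is the nonlinearity on the right of the eigenvalue equation.
\<close>

lemma signed_powr_split:
  assumes "0 \<le> (w::real)"
  shows "w powr p * \<bar>d\<bar> powr (p - 2) * d =
    w * (w * pos_part d) powr (p - 1) - w * (w * neg_part d) powr (p - 1)"
proof -
  have w: "w powr p = w * w powr (p - 1)"
    using assms by (cases "w = 0") (simp_all add: powr_mult_base)
  have d: "\<bar>d\<bar> powr (p - 2) * \<bar>d\<bar> = \<bar>d\<bar> powr (p - 1)"
    using powr_mult_base[of "\<bar>d\<bar>" "p - 2"] by (simp add: mult.commute)
  show ?thesis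
  proof (cases "0 \<le> d")
    case True
    then show ?thesis
      using assms d w by (simp add: pos_part_def neg_part_def powr_mult mult.assoc)
  next
    case False
    then have "pos_part d = 0" "neg_part d = - d" "\<bar>d\<bar> = - d"
      by (simp_all add: pos_part_def neg_part_def)
    moreover have "(w * - d) powr (p - 1) = w powr (p - 1) * (- d) powr (p - 1)"
      using False assms by (intro powr_mult)
    moreover have "(- d) powr (p - 2) * d = - ((- d) powr (p - 1))"
      using d False by simp
    ultimately show ?thesis
      using w by (simp add: mult.assoc)
  qed
qed

lemma p_eigen_equation_split:
  assumes "1 < p" "0 \<le> l" and weights: "\<And>v. v \<in> neighbours E u \<Longrightarrow> 0 < \<omega> u v"
    and eq: "p_laplacian E \<omega> p f u = l * \<bar>f u\<bar> powr (p - 2) * f u"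
  shows "(\<Sum>v\<in>neighbours E u. \<omega> u v * neg_part (grad \<omega> f u v) powr (p - 1))
       + (l powr (1 / (p - 1)) * neg_part (f u)) powr (p - 1)
     = (\<Sum>v\<in>neighbours E u. \<omega> u v * pos_part (grad \<omega> f u v) powr (p - 1))
       + (l powr (1 / (p - 1)) * pos_part (f u)) powr (p - 1)"
proof -
  have "\<omega> u v powr p * \<bar>f u - f v\<bar> powr (p - 2) * (f u - f v) =
      \<omega> u v * neg_part (grad \<omega> f u v) powr (p - 1) - \<omega> u v * pos_part (grad \<omega> f u v) powr (p - 1)"
    if "v \<in> neighbours E u" for v
  proof -
    have w: "0 < \<omega> u v" using weights that .
    have "\<omega> u v * pos_part (f u - f v) = neg_part (grad \<omega> f u v)"
      "\<omega> u v * neg_part (f u - f v) = pos_part (grad \<omega> f u v)"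
      using w by (auto simp: pos_part_def neg_part_def grad_def max_def algebra_simps
          mult_le_0_iff not_le dest: mult_left_le_imp_le)
    with signed_powr_split[of "\<omega> u v" p "f u - f v"] w show ?thesis by simp
  qed
  then have lhs: "p_laplacian E \<omega> p f u =
      (\<Sum>v\<in>neighbours E u. \<omega> u v * neg_part (grad \<omega> f u v) powr (p - 1))
      - (\<Sum>v\<in>neighbours E u. \<omega> u v * pos_part (grad \<omega> f u v) powr (p - 1))"
    by (simp add: p_laplacian_def sum_subtractf)
  have "\<bar>f u\<bar> powr (p - 2) * f u = pos_part (f u) powr (p - 1) - neg_part (f u) powr (p - 1)"
    using signed_powr_split[of 1 p "f u"] by simp
  moreover have "(l powr (1 / (p - 1)) * x) powr (p - 1) = l * x powr (p - 1)" if "0 \<le> x" for x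
  proof -
    have "(l powr (1 / (p - 1)) * x) powr (p - 1) = l powr (1 / (p - 1) * (p - 1)) * x powr (p - 1)"
      using that by (simp only: powr_mult powr_powr)
    then show ?thesis using assms(1,2) by (simp add: powr_one')
  qed
  ultimately have "l * \<bar>f u\<bar> powr (p - 2) * f u =
      (l powr (1 / (p - 1)) * pos_part (f u)) powr (p - 1)
      - (l powr (1 / (p - 1)) * neg_part (f u)) powr (p - 1)"
    by (simp add: pos_part_def neg_part_def mult.assoc right_diff_distrib)
  with lhs eq show ?thesis by simp
qed

section \<open>Passing to the limit\<close>

text \<open>
  The normalisation of the eigenvalues by \<open>1 / p\<close> may be replaced by \<open>1 / (p - 1)\<close>, the exponent
  that matches the homogeneity of the equation.
\<close>

lemma tendsto_root_shift:
  fixes l p :: "nat \<Rightarrow> real"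
  assumes p: "filterlim p at_top sequentially" "\<And>j. 1 < p j"
    and lim: "(\<lambda>j. l j powr (1 / p j)) \<longlonglongrightarrow> \<Lambda>"
  shows "(\<lambda>j. l j powr (1 / (p j - 1))) \<longlonglongrightarrow> \<Lambda>"
proof -
  have "filterlim (\<lambda>j. - 1 + p j) at_top sequentially"
    using p(1) by (intro filterlim_tendsto_add_at_top[OF tendsto_const])
  then have "(\<lambda>j. 1 / (- 1 + p j)) \<longlonglongrightarrow> 0"
    by (intro real_tendsto_divide_at_top[OF tendsto_const])
  from tendsto_add[OF tendsto_const[of 1] this]
  have "(\<lambda>j. 1 + 1 / (- 1 + p j)) \<longlonglongrightarrow> 1" by simp
  moreover have "1 + 1 / (- 1 + p j) = p j / (p j - 1)" for j
    using p(2)[of j] by (simp add: field_simps)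
  ultimately have ratio: "(\<lambda>j. p j / (p j - 1)) \<longlonglongrightarrow> 1" by simp
  have "(\<lambda>j. (l j powr (1 / p j)) powr (p j / (p j - 1))) \<longlonglongrightarrow> \<Lambda> powr 1"
    using lim ratio by (intro tendsto_powr') auto
  moreover have "(l j powr (1 / p j)) powr (p j / (p j - 1)) = l j powr (1 / (p j - 1))" for j
    using p(2)[of j] by (simp add: powr_powr)
  moreover have "0 \<le> \<Lambda>"
    using lim by (intro LIMSEQ_le_const[OF lim]) auto
  ultimately show ?thesis by (simp add: powr_one')
qed

text \<open>
  Treating \<open>\<Lambda> * f u\<close> by its positive and negative part, like the gradient, avoids a case
  distinction on the sign of \<open>F j u\<close>, which may keep changing when \<open>f u = 0\<close>.
\<close>

lemma limit_eigen_equation: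
  fixes p l :: "nat \<Rightarrow> real" and F :: "nat \<Rightarrow> 'a \<Rightarrow> real"
  assumes "weighted_graph_with_boundary V E \<omega> B"
    and p: "\<And>j. 1 < p j" "filterlim p at_top sequentially"
    and eig: "\<And>j. p_eigenpair V E \<omega> B (p j) (F j) (l j)"
    and F: "\<And>v. v \<in> V \<Longrightarrow> (\<lambda>j. F j v) \<longlonglongrightarrow> f v"
    and l: "(\<lambda>j. l j powr (1 / p j)) \<longlonglongrightarrow> \<Lambda>"
    and u: "u \<in> V - B"
  shows "max (grad_neg_norm E \<omega> f u) (\<Lambda> * neg_part (f u))
       = max (grad_pos_norm E \<omega> f u) (\<Lambda> * pos_part (f u))"
proof -
  interpret weighted_graph_with_boundary V E \<omega> B by fact
  define q where "q j = p j - 1" for j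
  have q: "\<And>j. 0 < q j" using p(1) by (simp add: q_def)
  have "filterlim (\<lambda>j. - 1 + p j) at_top sequentially"
    using p(2) by (intro filterlim_tendsto_add_at_top[OF tendsto_const])
  then have q_lim: "filterlim q at_top sequentially"
    by (simp add: q_def[abs_def])
  have nb: "neighbours E u \<subseteq> V" using edges_subset by (auto simp: neighbours_def)
  then have fin: "finite (neighbours E u)" using finite_nodes by (rule finite_subset)
  have weights: "0 < \<omega> u v" if "v \<in> neighbours E u" for v
    using that weight_pos by (simp add: neighbours_def)
  have root: "(\<lambda>j. l j powr (1 / q j)) \<longlonglongrightarrow> \<Lambda>"
    unfolding q_def by (intro tendsto_root_shift p l)
  \<comment> \<open>To be used for both sides of the split equation, with \<open>\<phi>\<close> the negative and the positive part.\<close>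
  have side: "(\<lambda>j. ((\<Sum>v\<in>neighbours E u. \<omega> u v * \<phi> (grad \<omega> (F j) u v) powr q j)
        + (l j powr (1 / q j) * \<phi> (F j u)) powr q j) powr (1 / q j))
      \<longlonglongrightarrow> max (max_or_zero ((\<lambda>v. \<phi> (grad \<omega> f u v)) ` neighbours E u)) (\<Lambda> * \<phi> (f u))"
    if \<phi>: "\<And>x. 0 \<le> \<phi> x" "\<And>X a. X \<longlonglongrightarrow> a \<Longrightarrow> (\<lambda>j::nat. \<phi> (X j)) \<longlonglongrightarrow> \<phi> a" for \<phi> :: "real \<Rightarrow> real"
  proof -
    let ?S = "\<lambda>j. \<Sum>v\<in>neighbours E u. \<omega> u v * \<phi> (grad \<omega> (F j) u v) powr q j"
    have "(\<lambda>j. ?S j powr (1 / q j))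
        \<longlonglongrightarrow> max_or_zero ((\<lambda>v. \<phi> (grad \<omega> f u v)) ` neighbours E u)"
      unfolding grad_def using nb u
      by (intro tendsto_weighted_power_mean q q_lim fin weights \<phi> tendsto_intros F) auto
    moreover have "(\<lambda>j. l j powr (1 / q j) * \<phi> (F j u)) \<longlonglongrightarrow> \<Lambda> * \<phi> (f u)"
      using u by (intro tendsto_mult root \<phi> F) auto
    ultimately have "(\<lambda>j. ((?S j powr (1 / q j)) powr q j
        + (l j powr (1 / q j) * \<phi> (F j u)) powr q j) powr (1 / q j))
      \<longlonglongrightarrow> max (max_or_zero ((\<lambda>v. \<phi> (grad \<omega> f u v)) ` neighbours E u)) (\<Lambda> * \<phi> (f u))"
      by (intro tendsto_power_mean_pair q q_lim) (auto simp: \<phi>)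
    moreover have "(?S j powr (1 / q j)) powr q j = ?S j" for j
    proof -
      have "0 \<le> ?S j"
        using weights by (intro sum_nonneg mult_nonneg_nonneg) (auto intro: less_imp_le)
      then show ?thesis using q[of j] by (simp add: powr_powr powr_one')
    qed
    ultimately show ?thesis by simp
  qed
  have "(\<Sum>v\<in>neighbours E u. \<omega> u v * neg_part (grad \<omega> (F j) u v) powr q j)
        + (l j powr (1 / q j) * neg_part (F j u)) powr q j
      = (\<Sum>v\<in>neighbours E u. \<omega> u v * pos_part (grad \<omega> (F j) u v) powr q j)
        + (l j powr (1 / q j) * pos_part (F j u)) powr q j" for j
    unfolding q_def using eig[of j] u
    by (intro p_eigen_equation_split p p_eigenvalue_nonneg[OF eig] weights)
      (auto simp: p_eigenpair_def)
  moreover have "(\<lambda>j::nat. neg_part (X j)) \<longlonglongrightarrow> neg_part a"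
    "(\<lambda>j::nat. pos_part (X j)) \<longlonglongrightarrow> pos_part a" if "X \<longlonglongrightarrow> a" for X a
    unfolding neg_part_def pos_part_def using that by (auto intro!: tendsto_max tendsto_minus)
  ultimately show ?thesis
    using side[of neg_part] side[of pos_part] LIMSEQ_unique
    unfolding grad_neg_norm_def grad_pos_norm_def
    by (fastforce simp: neg_part_def pos_part_def)
qed

theorem theorem3p1:
  fixes V :: "'a set" and E :: "('a \<times> 'a) set" and \<omega> :: "'a \<Rightarrow> 'a \<Rightarrow> real" and B :: "'a set"
    and p :: "nat \<Rightarrow> real" and fp :: "nat \<Rightarrow> 'a \<Rightarrow> real" and lp :: "nat \<Rightarrow> real"
    and f :: "'a \<Rightarrow> real" and \<Lambda> :: real
  assumes "weighted_graph_with_boundary V E \<omega> B"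
    and "\<And>j. 1 < p j"
    and "filterlim p at_top sequentially"
    and "\<And>j. p_eigenpair V E \<omega> B (p j) (fp j) (lp j)"
    and "\<And>v. v \<in> V \<Longrightarrow> (\<lambda>j. fp j v) \<longlonglongrightarrow> f v"
    and "(\<lambda>j. lp j powr (1 / p j)) \<longlonglongrightarrow> \<Lambda>"
  shows "\<forall>u\<in>V - B.
    0 = (if f u > 0 then min (grad_norm E \<omega> f u - \<Lambda> * f u) (inf_laplacian E \<omega> f u)
         else if f u = 0 then inf_laplacian E \<omega> f u
         else max (- grad_norm E \<omega> f u - \<Lambda> * f u) (inf_laplacian E \<omega> f u))"
proof
  fix u assume u: "u \<in> V - B"
  interpret weighted_graph_with_boundary V E \<omega> B by fact
  have "neighbours E u \<subseteq> V" using edges_subset by (auto simp: neighbours_def)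
  then have fin: "finite (neighbours E u)" using finite_nodes by (rule finite_subset)
  have eq: "max (grad_neg_norm E \<omega> f u) (\<Lambda> * neg_part (f u))
      = max (grad_pos_norm E \<omega> f u) (\<Lambda> * pos_part (f u))"
    using assms u by (rule limit_eigen_equation)
  have norm: "grad_norm E \<omega> f u = max (grad_neg_norm E \<omega> f u) (grad_pos_norm E \<omega> f u)"
    using fin unfolding grad_norm_def grad_neg_norm_def grad_pos_norm_def
    by (rule max_or_zero_abs)
  have nonneg: "0 \<le> grad_neg_norm E \<omega> f u" "0 \<le> grad_pos_norm E \<omega> f u"
    using fin unfolding grad_neg_norm_def grad_pos_norm_def neg_part_def pos_part_def
    by (auto intro!: max_or_zero_nonneg)
  consider "0 < f u" | "f u = 0" | "f u < 0" by linarith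
  then show "0 = (if f u > 0 then min (grad_norm E \<omega> f u - \<Lambda> * f u) (inf_laplacian E \<omega> f u)
         else if f u = 0 then inf_laplacian E \<omega> f u
         else max (- grad_norm E \<omega> f u - \<Lambda> * f u) (inf_laplacian E \<omega> f u))"
  proof cases
    case 1
    then have "grad_neg_norm E \<omega> f u = max (grad_pos_norm E \<omega> f u) (\<Lambda> * f u)"
      using eq nonneg by (simp add: neg_part_def pos_part_def)
    with 1 norm show ?thesis by (auto simp: inf_laplacian_def)
  next
    case 2
    then show ?thesis
      using eq nonneg by (simp add: neg_part_def pos_part_def inf_laplacian_def)
  next
    case 3
    then have "grad_pos_norm E \<omega> f u = max (grad_neg_norm E \<omega> f u) (- \<Lambda> * f u)"
      using eq nonneg by (simp add: neg_part_def pos_part_def)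
    with 3 norm show ?thesis by (auto simp: inf_laplacian_def)
  qed
qed

end
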